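(* Let $f:\mathbb{Z}^n\to\mathbb{R}\cup\{+\infty\}$ be a locally discrete midpoint convex function. (1) For any $z\in\mathbb{Z}^n$, the function $x\mapsto f(z+x)$ is locally discrete midpoint convex. (2) For any permutation $\sigma$ of $(1,2,\ldots,n)$, the function $x\mapsto f(x_{\sigma(1)},x_{\sigma(2)},\ldots,x_{\sigma(n)})$ is locally discrete midpoint convex. (3) The function $x\mapsto f(-x_1,-x_2,\ldots,-x_n)$ is locally discrete midpoint convex. (4) For any real numbers $a_1,a_2\ge0$ and any locally discrete midpoint convex functions $f_1,f_2:\mathbb{Z}^n\to\mathbb{R}\cup\{+\infty\}$, the function $g=a_1f_1+a_2f_2$ is locally discrete midpoint convex. That is, the class of locally discrete midpoint convex functions forms a convex cone.
   Context: For $x\in\mathbb{R}^n$, $\lceil x\rceil$ and $\lfloor x\rfloor$ denote the integer vectors obtained by rounding each component up, respectively down. The effective domain of $f:\mathbb{Z}^n\to\mathbb{R}\cup\{+\infty\}$ is $\operatorname{dom} f=\{x\in\mathbb{Z}^n\mid f(x)<+\infty\}$. A set $S\subseteq\mathbb{Z}^n$ is discrete midpoint convex if for all $x,y\in S$ with $\|x-y\|_\infty\ge2$ both $\lceil (x+y)/2\rceil$ and $\lfloor (x+y)/2\rfloor$ belong to $S$. $f$ is locally discrete midpoint convex if $\operatorname{dom} f$ is a discrete midpoint convex set and $$f(x)+f(y)\ge f(\lceil (x+y)/2\rceil)+f(\lfloor (x+y)/2\rfloor)$$ for all $x,y\in\mathbb{Z}^n$ with $\|x-y\|_\infty=2$.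 The combination $g=a_1f_1+a_2f_2$ is understood to have $\operatorname{dom} g=\operatorname{dom} f_1\cap\operatorname{dom} f_2$. *)

theory Defs
  imports "HOL-Analysis.Analysis" "HOL-Combinatorics.Permutations"
begin

definition real_vec :: "int ^ 'n \<Rightarrow> real ^ 'n" where
  "real_vec x = (\<chi> i. real_of_int (x $ i))"

definition ceil_vec :: "real ^ 'n \<Rightarrow> int ^ 'n" where
  "ceil_vec x = (\<chi> i. \<lceil>x $ i\<rceil>)"

definition floor_vec :: "real ^ 'n \<Rightarrow> int ^ 'n" where
  "floor_vec x = (\<chi> i. \<lfloor>x $ i\<rfloor>)"

definition effective_domain :: "(int ^ 'n \<Rightarrow> ereal) \<Rightarrow> (int ^ 'n) set" where
  "effective_domain f = {x. f x < \<infinity>}"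

definition discrete_midpoint_convex_set :: "(int ^ 'n) set \<Rightarrow> bool" where
  "discrete_midpoint_convex_set S \<longleftrightarrow>
     (\<forall>x\<in>S. \<forall>y\<in>S. infnorm (real_vec (x - y)) \<ge> 2 \<longrightarrow>
        ceil_vec (midpoint (real_vec x) (real_vec y)) \<in> S \<and>
        floor_vec (midpoint (real_vec x) (real_vec y)) \<in> S)"

text \<open>
  Functions with values in the reals extended by \<open>+\<infinity>\<close> only are rendered as functions into
  \<^typ>\<open>ereal\<close> that never take the value \<open>-\<infinity>\<close>; the first conjunct below expresses this
  restriction of the codomain.
\<close>

definition locally_discrete_midpoint_convex :: "(int ^ 'n \<Rightarrow> ereal) \<Rightarrow> bool" where
  "locally_discrete_midpoint_convex f \<longleftrightarrow>
     (\<forall>x. f x \<noteq> -\<infinity>) \<and>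
     discrete_midpoint_convex_set (effective_domain f) \<and>
     (\<forall>x y. infnorm (real_vec (x - y)) = 2 \<longrightarrow>
        f x + f y \<ge> f (ceil_vec (midpoint (real_vec x) (real_vec y)))
                   + f (floor_vec (midpoint (real_vec x) (real_vec y))))"

text \<open>
  The domain is intersected explicitly because \<open>0 * \<infinity> = 0\<close> in \<^typ>\<open>ereal\<close>: with a zero
  coefficient, the plain \<^typ>\<open>ereal\<close> expression would have too large an effective domain.
\<close>

definition combination ::
  "real \<Rightarrow> (int ^ 'n \<Rightarrow> ereal) \<Rightarrow> real \<Rightarrow> (int ^ 'n \<Rightarrow> ereal) \<Rightarrow> int ^ 'n \<Rightarrow> ereal" where
  "combination a\<^sub>1 f\<^sub>1 a\<^sub>2 f\<^sub>2 x =
     (if x \<in> effective_domain f\<^sub>1 \<inter> effective_domain f\<^sub>2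
      then ereal a\<^sub>1 * f\<^sub>1 x + ereal a\<^sub>2 * f\<^sub>2 x else \<infinity>)"

end

theory Submission imports Defs begin

text \<open>
  Each of the three transformations \<open>T\<close> (translation by an integer vector, permutation of the
  coordinates, negation) preserves the \<open>\<ell>\<^sub>\<infinity>\<close>-distance of integer points and maps the unordered pair
  of rounded midpoints of \<open>x\<close> and \<open>y\<close> to that of \<open>T x\<close> and \<open>T y\<close>. Translations and permutations
  commute with rounding up and with rounding down; negation exchanges the two, which is harmless
  because the defining conditions are symmetric in the two rounded midpoints. So composing with \<open>T\<close>
  preserves local discrete midpoint convexity
  (\<open>locally_discrete_midpoint_convex_compose\<close>).

  For a nonnegative combination, discrete midpoint convex sets are closed under intersection. The
  inequality is trivial if one of the two points lies outside the common domain. Otherwise both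
  rounded midpoints lie in it, since points at distance 2 are far enough apart for midpoint convexity
  of the domains to apply; so all values are finite and the two real inequalities can be scaled and
  added.
\<close>

abbreviation upper_midpoint :: "int ^ 'n \<Rightarrow> int ^ 'n \<Rightarrow> int ^ 'n" where
  "upper_midpoint x y \<equiv> ceil_vec (midpoint (real_vec x) (real_vec y))"

abbreviation lower_midpoint :: "int ^ 'n \<Rightarrow> int ^ 'n \<Rightarrow> int ^ 'n" where
  "lower_midpoint x y \<equiv> floor_vec (midpoint (real_vec x) (real_vec y))"

section \<open>Rounded midpoints\<close>

lemma upper_midpoint_nth:
  "upper_midpoint x y $ i = \<lceil>(real_of_int (x $ i) + real_of_int (y $ i)) / 2\<rceil>"
  by (simp add: ceil_vec_def midpoint_def real_vec_def)

lemma lower_midpoint_nth: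
  "lower_midpoint x y $ i = \<lfloor>(real_of_int (x $ i) + real_of_int (y $ i)) / 2\<rfloor>"
  by (simp add: floor_vec_def midpoint_def real_vec_def)

lemma midpoint_translate:
  "upper_midpoint (z + x) (z + y) = z + upper_midpoint x y"
  "lower_midpoint (z + x) (z + y) = z + lower_midpoint x y"
proof -
  have shift: "(real_of_int (z $ i + x $ i) + real_of_int (z $ i + y $ i)) / 2
      = (real_of_int (x $ i) + real_of_int (y $ i)) / 2 + real_of_int (z $ i)" for i
    by (simp add: field_simps)
  show "upper_midpoint (z + x) (z + y) = z + upper_midpoint x y"
    by (simp only: vec_eq_iff upper_midpoint_nth vector_add_component shift ceiling_add_of_int)
      (intro allI add.commute)
  show "lower_midpoint (z + x) (z + y) = z + lower_midpoint x y"
    by (simp only: vec_eq_iff lower_midpoint_nth vector_add_component shift floor_add_int[symmetric])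
      (intro allI add.commute)
qed

lemma midpoint_reindex:
  fixes x y :: "int ^ 'n" and \<sigma> :: "'m::finite \<Rightarrow> 'n"
  shows "upper_midpoint (\<chi> i. x $ \<sigma> i) (\<chi> i. y $ \<sigma> i) = (\<chi> i. upper_midpoint x y $ \<sigma> i)"
    and "lower_midpoint (\<chi> i. x $ \<sigma> i) (\<chi> i. y $ \<sigma> i) = (\<chi> i. lower_midpoint x y $ \<sigma> i)"
  by (simp_all add: vec_eq_iff upper_midpoint_nth lower_midpoint_nth)

lemma midpoint_uminus:
  "upper_midpoint (- x) (- y) = - lower_midpoint x y"
  "lower_midpoint (- x) (- y) = - upper_midpoint x y"
proof -
  have neg: "(real_of_int (- (x $ i)) + real_of_int (- (y $ i))) / 2
      = - ((real_of_int (x $ i) + real_of_int (y $ i)) / 2)" for i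
    by (simp add: field_simps)
  show "upper_midpoint (- x) (- y) = - lower_midpoint x y"
    by (simp only: vec_eq_iff upper_midpoint_nth lower_midpoint_nth vector_uminus_component neg
        ceiling_minus simp_thms)
  show "lower_midpoint (- x) (- y) = - upper_midpoint x y"
    by (simp only: vec_eq_iff upper_midpoint_nth lower_midpoint_nth vector_uminus_component neg
        floor_minus simp_thms)
qed

section \<open>Distances\<close>

text \<open>
  Surjectivity suffices: repeating a coordinate does not change a maximum of absolute values, but
  dropping one might.
\<close>

lemma infnorm_reindex:
  fixes x :: "real ^ 'n" and \<sigma> :: "'m::finite \<Rightarrow> 'n"
  assumes "surj \<sigma>"
  shows "infnorm (\<chi> i. x $ \<sigma> i) = infnorm x"
proof -
  have "{\<bar>x $ \<sigma> i\<bar> |i. i \<in> UNIV} = {\<bar>x $ i\<bar> |i. i \<in> UNIV}"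
    using assms by (auto simp: surj_def) metis
  then show ?thesis
    by (simp add: infnorm_cart)
qed

lemma infnorm_real_vec_uminus: "infnorm (real_vec (- x)) = infnorm (real_vec x)"
proof -
  have "real_vec (- x) = - real_vec x"
    by (simp add: real_vec_def vec_eq_iff)
  then show ?thesis
    by (simp add: infnorm_neg)
qed

section \<open>Composition with symmetries\<close>

text \<open>
  The two rounded midpoints enter both defining conditions symmetrically, so \<open>T\<close> may exchange
  them, and may do so for some pairs \<open>x\<close>, \<open>y\<close> only. The case of exchange is what negation needs.
\<close>

lemma locally_discrete_midpoint_convex_compose:
  fixes f :: "int ^ 'n \<Rightarrow> ereal" and T :: "int ^ 'm \<Rightarrow> int ^ 'n"
  assumes f: "locally_discrete_midpoint_convex f"
    and dist: "\<And>x y. infnorm (real_vec (T x - T y)) = infnorm (real_vec (x - y))"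
    and mid: "\<And>x y.
      upper_midpoint (T x) (T y) = T (upper_midpoint x y) \<and>
      lower_midpoint (T x) (T y) = T (lower_midpoint x y) \<or>
      upper_midpoint (T x) (T y) = T (lower_midpoint x y) \<and>
      lower_midpoint (T x) (T y) = T (upper_midpoint x y)"
  shows "locally_discrete_midpoint_convex (\<lambda>x. f (T x))"
  unfolding locally_discrete_midpoint_convex_def
proof (intro conjI allI impI)
  show "f (T x) \<noteq> -\<infinity>" for x
    using f by (simp add: locally_discrete_midpoint_convex_def)
  show "discrete_midpoint_convex_set (effective_domain (\<lambda>x. f (T x)))"
    unfolding discrete_midpoint_convex_set_def
  proof (intro ballI impI)
    fix x y
    assume "x \<in> effective_domain (\<lambda>x. f (T x))" "y \<in> effective_domain (\<lambda>x. f (T x))"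
      and "2 \<le> infnorm (real_vec (x - y))"
    then have "upper_midpoint (T x) (T y) \<in> effective_domain f \<and>
        lower_midpoint (T x) (T y) \<in> effective_domain f"
      using f dist[of x y]
      by (simp add: locally_discrete_midpoint_convex_def discrete_midpoint_convex_set_def
          effective_domain_def)
    then show "upper_midpoint x y \<in> effective_domain (\<lambda>x. f (T x)) \<and>
        lower_midpoint x y \<in> effective_domain (\<lambda>x. f (T x))"
      using mid[of x y] by (auto simp: effective_domain_def)
  qed
  fix x y :: "int ^ 'm"
  assume "infnorm (real_vec (x - y)) = 2"
  then have "f (upper_midpoint (T x) (T y)) + f (lower_midpoint (T x) (T y)) \<le> f (T x) + f (T y)"
    using f dist[of x y] by (simp add: locally_discrete_midpoint_convex_def)
  then show "f (T (upper_midpoint x y)) + f (T (lower_midpoint x y)) \<le> f (T x) + f (T y)"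
    using mid[of x y] by (auto simp: add.commute)
qed

lemma locally_discrete_midpoint_convex_translate:
  assumes "locally_discrete_midpoint_convex f"
  shows "locally_discrete_midpoint_convex (\<lambda>x. f (z + x))"
  by (rule locally_discrete_midpoint_convex_compose[OF assms]) (simp_all add: midpoint_translate)

lemma locally_discrete_midpoint_convex_reindex:
  fixes f :: "int ^ 'm \<Rightarrow> ereal" and \<sigma> :: "'m \<Rightarrow> 'n::finite"
  assumes f: "locally_discrete_midpoint_convex f" and \<sigma>: "surj \<sigma>"
  shows "locally_discrete_midpoint_convex (\<lambda>x. f (\<chi> i. x $ \<sigma> i))"
proof (rule locally_discrete_midpoint_convex_compose[OF f])
  fix x y :: "int ^ 'n"
  have "real_vec ((\<chi> i. x $ \<sigma> i) - (\<chi> i. y $ \<sigma> i)) = (\<chi> i. real_vec (x - y) $ \<sigma> i)"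
    by (simp add: real_vec_def vec_eq_iff)
  then show "infnorm (real_vec ((\<chi> i. x $ \<sigma> i) - (\<chi> i. y $ \<sigma> i))) = infnorm (real_vec (x - y))"
    by (simp add: infnorm_reindex[OF \<sigma>])
qed (simp add: midpoint_reindex)

lemma locally_discrete_midpoint_convex_uminus:
  assumes "locally_discrete_midpoint_convex f"
  shows "locally_discrete_midpoint_convex (\<lambda>x. f (- x))"
proof (rule locally_discrete_midpoint_convex_compose[OF assms])
  fix x y :: "int ^ 'a"
  show "infnorm (real_vec (- x - - y)) = infnorm (real_vec (x - y))"
    using infnorm_real_vec_uminus[of "x - y"] by simp
qed (simp add: midpoint_uminus)

section \<open>Nonnegative combinations\<close>

lemma discrete_midpoint_convex_set_Int:
  assumes "discrete_midpoint_convex_set S" "discrete_midpoint_convex_set T"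
  shows "discrete_midpoint_convex_set (S \<inter> T)"
  using assms unfolding discrete_midpoint_convex_set_def by blast

lemma finite_on_effective_domain:
  assumes "locally_discrete_midpoint_convex f" "x \<in> effective_domain f"
  obtains r where "f x = ereal r"
  using assms by (cases "f x") (auto simp: locally_discrete_midpoint_convex_def effective_domain_def)

lemma combination_eq_ereal:
  assumes "f\<^sub>1 x = ereal r" "f\<^sub>2 x = ereal s"
  shows "combination a\<^sub>1 f\<^sub>1 a\<^sub>2 f\<^sub>2 x = ereal (a\<^sub>1 * r + a\<^sub>2 * s)"
  using assms by (simp add: combination_def effective_domain_def)

lemma combination_not_MInf:
  assumes "locally_discrete_midpoint_convex f\<^sub>1" "locally_discrete_midpoint_convex f\<^sub>2"
  shows "combination a\<^sub>1 f\<^sub>1 a\<^sub>2 f\<^sub>2 x \<noteq> -\<infinity>"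
proof (cases "x \<in> effective_domain f\<^sub>1 \<inter> effective_domain f\<^sub>2")
  case True
  then obtain r s where "f\<^sub>1 x = ereal r" "f\<^sub>2 x = ereal s"
    using assms by (blast elim: finite_on_effective_domain)
  then show ?thesis
    by (simp add: combination_eq_ereal)
next
  case False
  then show ?thesis
    by (auto simp: combination_def)
qed

lemma effective_domain_combination:
  assumes "locally_discrete_midpoint_convex f\<^sub>1" "locally_discrete_midpoint_convex f\<^sub>2"
  shows "effective_domain (combination a\<^sub>1 f\<^sub>1 a\<^sub>2 f\<^sub>2) = effective_domain f\<^sub>1 \<inter> effective_domain f\<^sub>2"
proof (intro set_eqI iffI)
  fix x
  assume "x \<in> effective_domain (combination a\<^sub>1 f\<^sub>1 a\<^sub>2 f\<^sub>2)"
  then show "x \<in> effective_domain f\<^sub>1 \<inter> effective_domain f\<^sub>2"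
    by (auto simp: effective_domain_def combination_def split: if_splits)
next
  fix x
  assume "x \<in> effective_domain f\<^sub>1 \<inter> effective_domain f\<^sub>2"
  then obtain r s where "f\<^sub>1 x = ereal r" "f\<^sub>2 x = ereal s"
    using assms by (blast elim: finite_on_effective_domain)
  then show "x \<in> effective_domain (combination a\<^sub>1 f\<^sub>1 a\<^sub>2 f\<^sub>2)"
    by (simp add: effective_domain_def combination_eq_ereal)
qed

lemma locally_discrete_midpoint_convex_combination:
  fixes f\<^sub>1 f\<^sub>2 :: "int ^ 'n \<Rightarrow> ereal"
  assumes a: "a\<^sub>1 \<ge> 0" "a\<^sub>2 \<ge> 0"
    and f1: "locally_discrete_midpoint_convex f\<^sub>1"
    and f2: "locally_discrete_midpoint_convex f\<^sub>2"
  shows "locally_discrete_midpoint_convex (combination a\<^sub>1 f\<^sub>1 a\<^sub>2 f\<^sub>2)"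
    (is "locally_discrete_midpoint_convex ?g")
proof -
  have dom: "discrete_midpoint_convex_set (effective_domain f\<^sub>1 \<inter> effective_domain f\<^sub>2)"
    using f1 f2
    by (simp add: locally_discrete_midpoint_convex_def discrete_midpoint_convex_set_Int)
  have ineq: "?g (upper_midpoint x y) + ?g (lower_midpoint x y) \<le> ?g x + ?g y"
    if d: "infnorm (real_vec (x - y)) = 2" for x y
  proof (cases "x \<in> effective_domain f\<^sub>1 \<inter> effective_domain f\<^sub>2 \<and>
      y \<in> effective_domain f\<^sub>1 \<inter> effective_domain f\<^sub>2")
    case False
    then have "?g x = \<infinity> \<or> ?g y = \<infinity>"
      by (auto simp: combination_def)
    then show ?thesis
      by auto
  next
    case True
    define u l where "u = upper_midpoint x y" and "l = lower_midpoint x y"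
    have ul: "u \<in> effective_domain f\<^sub>1 \<inter> effective_domain f\<^sub>2"
      "l \<in> effective_domain f\<^sub>1 \<inter> effective_domain f\<^sub>2"
      using dom True d unfolding discrete_midpoint_convex_set_def u_def l_def by auto
    obtain x1 y1 u1 l1 where v1:
      "f\<^sub>1 x = ereal x1" "f\<^sub>1 y = ereal y1" "f\<^sub>1 u = ereal u1" "f\<^sub>1 l = ereal l1"
      using finite_on_effective_domain[OF f1] True ul by (metis IntD1)
    obtain x2 y2 u2 l2 where v2:
      "f\<^sub>2 x = ereal x2" "f\<^sub>2 y = ereal y2" "f\<^sub>2 u = ereal u2" "f\<^sub>2 l = ereal l2"
      using finite_on_effective_domain[OF f2] True ul by (metis IntD2)
    have "f\<^sub>1 u + f\<^sub>1 l \<le> f\<^sub>1 x + f\<^sub>1 y" "f\<^sub>2 u + f\<^sub>2 l \<le> f\<^sub>2 x + f\<^sub>2 y"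
      using f1 f2 d by (simp_all add: locally_discrete_midpoint_convex_def u_def l_def)
    then have "u1 + l1 \<le> x1 + y1" "u2 + l2 \<le> x2 + y2"
      by (simp_all add: v1 v2)
    then have "a\<^sub>1 * (u1 + l1) + a\<^sub>2 * (u2 + l2) \<le> a\<^sub>1 * (x1 + y1) + a\<^sub>2 * (x2 + y2)"
      using a by (meson add_mono mult_left_mono)
    moreover have "?g x = ereal (a\<^sub>1 * x1 + a\<^sub>2 * x2)" "?g y = ereal (a\<^sub>1 * y1 + a\<^sub>2 * y2)"
      "?g u = ereal (a\<^sub>1 * u1 + a\<^sub>2 * u2)" "?g l = ereal (a\<^sub>1 * l1 + a\<^sub>2 * l2)"
      using v1 v2 by (simp_all add: combination_eq_ereal)
    ultimately have "?g u + ?g l \<le> ?g x + ?g y"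
      by (simp add: algebra_simps)
    then show ?thesis
      by (simp add: u_def l_def)
  qed
  show ?thesis
    unfolding locally_discrete_midpoint_convex_def effective_domain_combination[OF f1 f2]
    using combination_not_MInf[OF f1 f2] dom ineq by blast
qed

theorem proposition2p14:
  fixes f :: "int ^ 'n \<Rightarrow> ereal"
  assumes "locally_discrete_midpoint_convex f"
  shows "(\<forall>z. locally_discrete_midpoint_convex (\<lambda>x. f (z + x))) \<and>
         (\<forall>\<sigma>. \<sigma> permutes (UNIV :: 'n set) \<longrightarrow>
            locally_discrete_midpoint_convex (\<lambda>x. f (\<chi> i. x $ \<sigma> i))) \<and>
         locally_discrete_midpoint_convex (\<lambda>x. f (- x)) \<and>
         (\<forall>(a\<^sub>1 :: real) (a\<^sub>2 :: real) (f\<^sub>1 :: int ^ 'n \<Rightarrow> ereal) (f\<^sub>2 :: int ^ 'n \<Rightarrow> ereal).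
            a\<^sub>1 \<ge> 0 \<longrightarrow> a\<^sub>2 \<ge> 0 \<longrightarrow>
            locally_discrete_midpoint_convex f\<^sub>1 \<longrightarrow> locally_discrete_midpoint_convex f\<^sub>2 \<longrightarrow>
            locally_discrete_midpoint_convex (combination a\<^sub>1 f\<^sub>1 a\<^sub>2 f\<^sub>2))"
proof (intro conjI allI impI)
  show "locally_discrete_midpoint_convex (\<lambda>x. f (z + x))" for z
    by (rule locally_discrete_midpoint_convex_translate[OF assms])
  show "locally_discrete_midpoint_convex (\<lambda>x. f (\<chi> i. x $ \<sigma> i))"
    if "\<sigma> permutes (UNIV :: 'n set)" for \<sigma>
    by (rule locally_discrete_midpoint_convex_reindex[OF assms permutes_surj[OF that]])
  show "locally_discrete_midpoint_convex (\<lambda>x. f (- x))"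
    by (rule locally_discrete_midpoint_convex_uminus[OF assms])
qed (rule locally_discrete_midpoint_convex_combination)

end
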